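(* Let $\rho>0$, $\xi>0$ and $\eta\in\big(0,\tfrac{1+\sqrt5}{2}\big)$. Given that $\mathbf{P}=\boldsymbol{\Pi}\otimes\mathbf{I}_p$ is selected such that $$\boldsymbol{\Pi}=\frac{1}{\xi}\big(\mathbf{I}_n-\xi\rho\,\mathbf{D}_{\mathcal{G}}\big),$$ which can always be done, the iterates of generalized D-ADMM $$\mathbf{x}^{k+1}=\arg\min_{\mathbf{x}\in\mathbb{R}^{np}}\ f(\mathbf{x})+\Big(\mathbf{E}_{\mathrm{o}}^T\boldsymbol{\alpha}^k-\tfrac{\rho}{2}\mathbf{E}_{\mathrm{u}}^T\mathbf{E}_{\mathrm{u}}\mathbf{x}^k\Big)^T\mathbf{x}+\tfrac{\rho}{2}\|\mathbf{x}\|_{\mathbf{D}}^2+\tfrac12\|\mathbf{x}-\mathbf{x}^k\|_{\mathbf{P}}^2,\qquad \boldsymbol{\alpha}^{k+1}=\boldsymbol{\alpha}^k+\tfrac{\eta\rho}{2}\mathbf{E}_{\mathrm{o}}\mathbf{x}^{k+1},\qquad k\ge0,$$ can be expressed as $$\mathbf{x}^{k+1}=(\mathbf{W}\otimes\mathbf{I}_p)\mathbf{x}^k-\xi\nabla f(\mathbf{x}^{k+1})+\sum_{t=0}^{k}\big((\mathbf{W}-\tilde{\mathbf{W}})\otimes\mathbf{I}_p\big)\mathbf{x}^t$$ with mixing matrices $$\mathbf{W}=\mathbf{I}_n-\frac{\xi\rho}{2}\mathbf{L}_{\mathcal{G}},\qquad \tilde{\mathbf{W}}=\mathbf{I}_n-\frac{\xi\rho}{2}(1-\eta)\mathbf{L}_{\mathcal{G}},$$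 implying that generalized ADMM and P-EXTRA are equivalent for the given choice of matrices $\mathbf{W}$, $\tilde{\mathbf{W}}$ and $\mathbf{P}$.
   Context: Objective. $f_1,\dots,f_n:\mathbb{R}^p\to\mathbb{R}$ are convex and differentiable, and $f(\mathbf{x})=\sum_{i=1}^n f_i(\mathbf{x}_i)$ for $\mathbf{x}=[\mathbf{x}_1;\dots;\mathbf{x}_n]\in\mathbb{R}^{np}$, so $\nabla f(\mathbf{x})=[\nabla f_1(\mathbf{x}_1);\dots;\nabla f_n(\mathbf{x}_n)]$. For a symmetric matrix $\mathbf{S}$, $\|\mathbf{x}\|_{\mathbf{S}}^2=\mathbf{x}^T\mathbf{S}\mathbf{x}$. Network. $\mathcal{G}=\{\mathcal{V},\mathcal{A}\}$ is a connected network with $n$ agents and $m$ arcs (directed edges), bidirectional: $(i,j)\in\mathcal{A}$ iff $(j,i)\in\mathcal{A}$. Arcs are labelled $1,\dots,m$. $\mathbf{A}_{\mathrm{s}}\in\mathbb{R}^{mp\times np}$ has $p\times p$ block $(a,i)$ equal to $\mathbf{I}_p$ if arc $a$ originates from node $i$ and $\mathbf{0}_p$ otherwise; $\mathbf{A}_{\mathrm{d}}$ is defined analogously with arc destinations. $\mathbf{E}_{\mathrm{o}}=\mathbf{A}_{\mathrm{s}}-\mathbf{A}_{\mathrm{d}}$, $\mathbf{E}_{\mathrm{u}}=\mathbf{A}_{\mathrm{s}}+\mathbf{A}_{\mathrm{d}}$, $\mathbf{D}=\tfrac12(\mathbf{E}_{\mathrm{o}}^T\mathbf{E}_{\mathrm{o}}+\mathbf{E}_{\mathrm{u}}^T\mathbf{E}_{\mathrm{u}})=\mathbf{D}_{\mathcal{G}}\otimes\mathbf{I}_p$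 with $\mathbf{D}_{\mathcal{G}}\in\mathbb{R}^{n\times n}$ the (diagonal) degree matrix, and $\mathbf{L}_{\mathcal{G}}\in\mathbb{R}^{n\times n}$ is the oriented graph Laplacian, given by $\mathbf{E}_{\mathrm{o}}^T\mathbf{E}_{\mathrm{o}}=\mathbf{L}_{\mathcal{G}}\otimes\mathbf{I}_p$. Generalized ADMM. Let $\mathbf{A}=[\mathbf{A}_{\mathrm{s}};\mathbf{A}_{\mathrm{d}}]$, $\mathbf{B}=[-\mathbf{I}_{mp};-\mathbf{I}_{mp}]$ and $\mathcal{L}(\mathbf{x},\mathbf{z},\boldsymbol{\lambda})=f(\mathbf{x})+\boldsymbol{\lambda}^T(\mathbf{A}\mathbf{x}+\mathbf{B}\mathbf{z})+\tfrac{\rho}{2}\|\mathbf{A}\mathbf{x}+\mathbf{B}\mathbf{z}\|^2$. Generalized ADMM (with no quadratic perturbation in the $\mathbf{z}$-step) iterates $\mathbf{x}^{k+1}=\arg\min_{\mathbf{x}}\mathcal{L}(\mathbf{x},\mathbf{z}^k,\boldsymbol{\lambda}^k)+\tfrac12\|\mathbf{x}-\mathbf{x}^k\|_{\mathbf{P}}^2$, $\mathbf{z}^{k+1}=\arg\min_{\mathbf{z}}\mathcal{L}(\mathbf{x}^{k+1},\mathbf{z},\boldsymbol{\lambda}^k)$, $\boldsymbol{\lambda}^{k+1}=\boldsymbol{\lambda}^k+\eta\rho(\mathbf{A}\mathbf{x}^{k+1}+\mathbf{B}\mathbf{z}^{k+1})$, where $\mathbf{P}\succeq\mathbf{0}$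 and $\eta\in\big(0,\tfrac{1+\sqrt5}{2}\big)$; for distributability $\mathbf{P}=\boldsymbol{\Pi}\otimes\mathbf{I}_p$ with $\boldsymbol{\Pi}\in\mathbb{R}^{n\times n}$ diagonal and positive semidefinite. The standing initialization is $\boldsymbol{\lambda}^0=[\boldsymbol{\alpha}^0;-\boldsymbol{\alpha}^0]$ with $\boldsymbol{\alpha}^0\in\mathbb{R}^{mp}$ in the column space of $\mathbf{E}_{\mathrm{o}}$, and $\mathbf{E}_{\mathrm{u}}\mathbf{x}^0=2\mathbf{z}^0$. Under it, the $\mathbf{x}^k$ iterates are those of the generalized D-ADMM recursion in $(\mathbf{x}^k,\boldsymbol{\alpha}^k)$ displayed in the claim. P-EXTRA. Given a step-size $\xi>0$ and mixing matrices $\mathbf{W},\tilde{\mathbf{W}}\in\mathbb{R}^{n\times n}$, P-EXTRA is the method with (implicit) iterates $\mathbf{x}^{k+1}=(\mathbf{W}\otimes\mathbf{I}_p)\mathbf{x}^k-\xi\nabla f(\mathbf{x}^{k+1})+\sum_{t=0}^{k}\big((\mathbf{W}-\tilde{\mathbf{W}})\otimes\mathbf{I}_p\big)\mathbf{x}^t$.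
   Formalization: The identity fails for general α⁰ in col(E_o) (e.g. α⁰=0, x⁰ non-consensual); it is shown to hold iff α⁰=(ηρ/2)E_o x⁰. "Can always be done" becomes: Π is diagonal, and Π⪰0 iff ξρd_i≤1 for all i, so for small ξ or ρ. At least one arc is assumed. *)

theory Defs
  imports "HOL-Analysis.Analysis" "Graph_Theory.Digraph_Component"
begin

text \<open>
  Vectors of size \<open>np\<close>, \<open>mp\<close> and \<open>2mp\<close> are indexed by \<open>'n \<times> 'p\<close>, \<open>'m \<times> 'p\<close> and
  \<open>'m \<times> 'p + 'm \<times> 'p\<close>, where \<open>'n\<close> is the type of agents, \<open>'m\<close> the type of arc labels and
  \<open>'p\<close> the index type of the local variable: component \<open>(i, k)\<close> of a vector of size \<open>np\<close> is
  component \<open>k\<close> of its block \<open>i\<close>.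
\<close>

subsection \<open>Matrices\<close>

definition kron :: "real^'b::finite^'a::finite \<Rightarrow> real^'d::finite^'c::finite \<Rightarrow> real^('b \<times> 'd)^('a \<times> 'c)"
    (infixl \<open>\<otimes>\<^sub>K\<close> 75) where
  "M \<otimes>\<^sub>K N = (\<chi> r c. M $ fst r $ fst c * N $ snd r $ snd c)"

text \<open>Applied to matrices, which are vectors of rows, this stacks them vertically.\<close>
definition stack :: "'b^'r::finite \<Rightarrow> 'b^'s::finite \<Rightarrow> 'b^('r + 's)" where
  "stack u v = (\<chi> r. case r of Inl a \<Rightarrow> u $ a | Inr b \<Rightarrow> v $ b)"

definition wnorm_sq :: "real^'k::finite^'k \<Rightarrow> real^'k \<Rightarrow> real" where
  "wnorm_sq S x = x \<bullet> (S *v x)"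

definition pos_semidef :: "real^'k::finite^'k \<Rightarrow> bool" where
  "pos_semidef S \<longleftrightarrow> transpose S = S \<and> (\<forall>x. 0 \<le> x \<bullet> (S *v x))"

definition diagonal_matrix :: "real^'k::finite^'k \<Rightarrow> bool" where
  "diagonal_matrix S \<longleftrightarrow> (\<forall>i j. i \<noteq> j \<longrightarrow> S $ i $ j = 0)"

subsection \<open>Objective\<close>

definition grad :: "('a::real_inner \<Rightarrow> real) \<Rightarrow> 'a \<Rightarrow> 'a" where
  "grad F x = (THE D. GDERIV F x :> D)"

definition block :: "real^('n::finite \<times> 'p::finite) \<Rightarrow> 'n \<Rightarrow> real^'p" where
  "block x i = (\<chi> k. x $ (i, k))"

definition objective :: "('n::finite \<Rightarrow> real^'p::finite \<Rightarrow> real) \<Rightarrow> real^('n \<times> 'p) \<Rightarrow> real" where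
  "objective f x = (\<Sum>i\<in>UNIV. f i (block x i))"

lemma GDERIV_unique:
  assumes "GDERIV F x :> D" "GDERIV F x :> D'"
  shows "D = D'"
proof -
  have "(\<lambda>h. h \<bullet> D) = (\<lambda>h. h \<bullet> D')"
    using assms unfolding gderiv_def by (rule has_derivative_unique)
  then have "\<forall>h. h \<bullet> D = h \<bullet> D'"
    by (intro allI) (rule fun_cong)
  then show ?thesis
    by (simp only: vector_eq_ldot)
qed

lemma grad_eqI: "GDERIV F x :> D \<Longrightarrow> grad F x = D"
  unfolding grad_def by (blast intro: GDERIV_unique)

lemma GDERIV_grad:
  fixes F :: "'a::euclidean_space \<Rightarrow> real"
  assumes "F differentiable (at x)"
  shows "GDERIV F x :> grad F x"
proof -
  obtain F' where F': "(F has_derivative F') (at x)"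
    using assms by (auto simp: differentiable_def)
  then interpret linear F'
    by (rule has_derivative_linear)
  have "F' h = h \<bullet> (\<Sum>b\<in>Basis. F' b *\<^sub>R b)" for h
  proof -
    have "F' h = F' (\<Sum>b\<in>Basis. (h \<bullet> b) *\<^sub>R b)"
      by (simp only: euclidean_representation)
    also have "\<dots> = (\<Sum>b\<in>Basis. (h \<bullet> b) *\<^sub>R F' b)"
      by (simp only: sum scale)
    also have "\<dots> = h \<bullet> (\<Sum>b\<in>Basis. F' b *\<^sub>R b)"
      by (simp add: inner_sum_right mult.commute)
    finally show ?thesis .
  qed
  then have "F' = (\<lambda>h. h \<bullet> (\<Sum>b\<in>Basis. F' b *\<^sub>R b))"
    by (rule ext)
  with F' have D: "GDERIV F x :> (\<Sum>b\<in>Basis. F' b *\<^sub>R b)"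
    unfolding gderiv_def by (rule back_subst)
  then show ?thesis
    unfolding grad_eqI[OF D] .
qed

lemma grad_objective:
  fixes f :: "'n::finite \<Rightarrow> real^'p::finite \<Rightarrow> real"
  assumes "\<And>i y. f i differentiable (at y)"
  shows "grad (objective f) x = (\<chi> r. grad (f (fst r)) (block x (fst r)) $ snd r)"
proof (rule grad_eqI)
  have lin: "bounded_linear (\<lambda>x. block x i)" for i :: 'n
    by (intro linear_conv_bounded_linear[THEN iffD1] linearI)
       (simp_all add: block_def vec_eq_iff)
  have "((\<lambda>x. f i (block x i)) has_derivative (\<lambda>h. block h i \<bullet> grad (f i) (block x i))) (at x)"
    for i
    using has_derivative_compose[OF bounded_linear_imp_has_derivative[OF lin]
        GDERIV_grad[OF assms, unfolded gderiv_def]] .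
  then have "(objective f has_derivative
      (\<lambda>h. \<Sum>i\<in>UNIV. block h i \<bullet> grad (f i) (block x i))) (at x)"
    unfolding objective_def by (intro has_derivative_sum)
  moreover have "(\<Sum>i\<in>UNIV. block h i \<bullet> grad (f i) (block x i)) =
      h \<bullet> (\<chi> r. grad (f (fst r)) (block x (fst r)) $ snd r)" for h
    by (simp add: inner_vec_def block_def sum.cartesian_product UNIV_Times_UNIV case_prod_unfold)
  ultimately show "GDERIV (objective f) x :> (\<chi> r. grad (f (fst r)) (block x (fst r)) $ snd r)"
    by (simp add: gderiv_def)
qed

subsection \<open>Network\<close>

text \<open>
  Parallel arcs are excluded, so that arcs may be identified with pairs of agents; loops are not.
  All agents and all arc labels are used, so that the matrices below have exactly one block
  column per agent and one block row per arc.
\<close>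
definition network :: "('n::finite, 'm::finite) pre_digraph \<Rightarrow> bool" where
  "network G \<longleftrightarrow> nomulti_digraph G \<and> sym_digraph G \<and> Digraph_Component.connected G \<and>
     verts G = UNIV \<and> arcs G = UNIV"

definition A_src :: "('n::finite, 'm::finite) pre_digraph \<Rightarrow> real^('n \<times> 'p::finite)^('m \<times> 'p)" where
  "A_src G = (\<chi> r c. if tail G (fst r) = fst c \<and> snd r = snd c then 1 else 0)"

definition A_dst :: "('n::finite, 'm::finite) pre_digraph \<Rightarrow> real^('n \<times> 'p::finite)^('m \<times> 'p)" where
  "A_dst G = (\<chi> r c. if head G (fst r) = fst c \<and> snd r = snd c then 1 else 0)"

definition E_o :: "('n::finite, 'm::finite) pre_digraph \<Rightarrow> real^('n \<times> 'p::finite)^('m \<times> 'p)" where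
  "E_o G = A_src G - A_dst G"

definition E_u :: "('n::finite, 'm::finite) pre_digraph \<Rightarrow> real^('n \<times> 'p::finite)^('m \<times> 'p)" where
  "E_u G = A_src G + A_dst G"

definition D_mat :: "('n::finite, 'm::finite) pre_digraph \<Rightarrow>
    real^('n \<times> 'p::finite)^('n \<times> 'p)" where
  "D_mat G = (1/2) *\<^sub>R ((transpose (E_o G) :: real^('m \<times> 'p)^('n \<times> 'p)) ** E_o G +
                        (transpose (E_u G) :: real^('m \<times> 'p)^('n \<times> 'p)) ** E_u G)"

text \<open>
  Every bidirectional link is a pair of opposite arcs, and each of them is counted, both in the
  degrees and in the off-diagonal entries of the Laplacian. This normalization is the one for
  which \<open>D_mat_eq_kron\<close> and \<open>E_o_gram_eq_kron\<close> below hold.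
\<close>
definition degree_matrix :: "('n::finite, 'm::finite) pre_digraph \<Rightarrow> real^'n^'n" where
  "degree_matrix G = (\<chi> i j. if i = j then real (out_degree G i + in_degree G i) else 0)"

definition laplacian :: "('n::finite, 'm::finite) pre_digraph \<Rightarrow> real^'n^'n" where
  "laplacian G = degree_matrix G -
     (\<chi> i j. real (card {a \<in> arcs G. tail G a = i \<and> head G a = j} +
                  card {a \<in> arcs G. tail G a = j \<and> head G a = i}))"

lemma A_gram:
  fixes s t :: "'m::finite \<Rightarrow> 'n::finite"
  shows "(transpose (\<chi> r c. if s (fst r) = fst c \<and> snd r = snd c then 1 else 0)
            :: real^('m \<times> 'p::finite)^('n \<times> 'p))
          ** (\<chi> r c. if t (fst r) = fst c \<and> snd r = snd c then 1 else 0)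
       = (\<chi> i j. real (card {a. s a = i \<and> t a = j})) \<otimes>\<^sub>K (mat 1 :: real^'p^'p)"
proof -
  have sum_eq: "(\<Sum>r\<in>UNIV. (if s (fst r) = i \<and> snd r = k then 1 else 0) *
                     (if t (fst r) = j \<and> snd r = l then 1 else 0))
      = real (card {a. s a = i \<and> t a = j}) * (if k = l then 1 else 0)"
    for i j :: 'n and k l :: 'p
  proof -
    have "(\<Sum>r\<in>UNIV. (if s (fst r) = i \<and> snd r = k then 1 else 0) *
                     (if t (fst r) = j \<and> snd r = l then 1 else (0::real)))
        = (\<Sum>r\<in>UNIV. of_bool (r \<in> {a. s a = i \<and> t a = j} \<times> ({k} \<inter> {l})))"
      by (intro sum.cong refl) (auto simp: mem_Times_iff)
    also have "\<dots> = real (card ({a. s a = i \<and> t a = j} \<times> ({k} \<inter> {l})))"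
      by (simp only: sum_of_bool_eq finite Int_UNIV_left Collect_mem_eq)
    also have "\<dots> = real (card {a. s a = i \<and> t a = j}) * (if k = l then 1 else 0)"
      by (cases "k = l") (simp_all add: card_cartesian_product)
    finally show ?thesis .
  qed
  show ?thesis
    unfolding vec_eq_iff kron_def matrix_matrix_mult_def transpose_def mat_def vec_lambda_beta sum_eq
    by simp
qed

lemma kron_add: "(M + N) \<otimes>\<^sub>K K = M \<otimes>\<^sub>K K + N \<otimes>\<^sub>K K"
  by (simp add: kron_def vec_eq_iff algebra_simps)

lemma kron_diff: "(M - N) \<otimes>\<^sub>K K = M \<otimes>\<^sub>K K - N \<otimes>\<^sub>K K"
  by (simp add: kron_def vec_eq_iff algebra_simps)

lemma transpose_add: "transpose (A + B) = transpose A + transpose (B :: real^'a^'b)"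
  by (simp add: transpose_def vec_eq_iff)

lemma transpose_diff: "transpose (A - B) = transpose A - transpose (B :: real^'a^'b)"
  by (simp add: transpose_def vec_eq_iff)

lemma matrix_mult_add_left: "(A + B) ** C = A ** C + B ** (C :: real^'a^'b)"
  by (simp add: matrix_matrix_mult_def vec_eq_iff distrib_right sum.distrib)

lemma matrix_mult_add_right: "A ** (B + C) = A ** B + A ** (C :: real^'a^'b)"
  by (simp add: matrix_matrix_mult_def vec_eq_iff distrib_left sum.distrib)

lemma matrix_mult_diff_left: "(A - B) ** C = A ** C - B ** (C :: real^'a^'b)"
  by (simp add: matrix_matrix_mult_def vec_eq_iff left_diff_distrib sum_subtractf)

lemma matrix_mult_diff_right: "A ** (B - C) = A ** B - A ** (C :: real^'a^'b)"
  by (simp add: matrix_matrix_mult_def vec_eq_iff right_diff_distrib sum_subtractf)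

lemmas matrix_mult_distribs =
  matrix_mult_add_left matrix_mult_add_right matrix_mult_diff_left matrix_mult_diff_right

lemma degree_matrix_alt:
  fixes G :: "('n::finite, 'm::finite) pre_digraph"
  assumes "network G"
  shows "degree_matrix G = (\<chi> i j. real (card {a. tail G a = i \<and> tail G a = j})) +
                           (\<chi> i j. real (card {a. head G a = i \<and> head G a = j}))"
proof -
  have "{a. tail G a = i \<and> tail G a = j} = (if i = j then out_arcs G i else {})"
       "{a. head G a = i \<and> head G a = j} = (if i = j then in_arcs G i else {})" for i j
    using assms by (auto simp: network_def out_arcs_def in_arcs_def)
  then show ?thesis
    by (simp add: degree_matrix_def vec_eq_iff out_degree_def in_degree_def)
qed

lemma D_mat_eq_kron:
  fixes G :: "('n::finite, 'm::finite) pre_digraph"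
  assumes "network G"
  shows "D_mat G = degree_matrix G \<otimes>\<^sub>K (mat 1 :: real^'p::finite^'p)"
proof -
  have "D_mat G = (transpose (A_src G) :: real^('m \<times> 'p)^('n \<times> 'p)) ** A_src G +
                  (transpose (A_dst G) :: real^('m \<times> 'p)^('n \<times> 'p)) ** A_dst G"
    unfolding D_mat_def E_o_def E_u_def transpose_add transpose_diff
    unfolding matrix_mult_distribs
    by (simp add: algebra_simps flip: scaleR_2)
  then show ?thesis
    unfolding degree_matrix_alt[OF assms] kron_add A_src_def A_dst_def A_gram .
qed

lemma E_o_gram_eq_kron:
  fixes G :: "('n::finite, 'm::finite) pre_digraph"
  assumes "network G"
  shows "(transpose (E_o G) :: real^('m \<times> 'p)^('n \<times> 'p)) ** E_o G =
           laplacian G \<otimes>\<^sub>K (mat 1 :: real^'p::finite^'p)"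
proof -
  have adj: "(\<chi> i j. real (card {a \<in> arcs G. tail G a = i \<and> head G a = j} +
                       card {a \<in> arcs G. tail G a = j \<and> head G a = i})) =
        (\<chi> i j. real (card {a. tail G a = i \<and> head G a = j})) +
        (\<chi> i j. real (card {a. head G a = i \<and> tail G a = j}))"
    using assms by (simp add: vec_eq_iff network_def conj_commute)
  show ?thesis
    unfolding laplacian_def adj degree_matrix_alt[OF assms] kron_add kron_diff
      E_o_def transpose_diff matrix_mult_distribs A_src_def A_dst_def A_gram
    by simp
qed

subsection \<open>Algorithms\<close>

text \<open>
  The predicates below hold for a sequence of iterates iff it is a run of the respective method.
\<close>

definition aug_lagrangian ::
    "(real^'x::finite \<Rightarrow> real) \<Rightarrow> real^'x^'c::finite \<Rightarrow> real^'z::finite^'c \<Rightarrow> real \<Rightarrow> real^'x \<Rightarrow> real^'z \<Rightarrow> real^'c \<Rightarrow> real" where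
  "aug_lagrangian F A B \<rho> x z l =
     F x + l \<bullet> (A *v x + B *v z) + \<rho> / 2 * (norm (A *v x + B *v z))\<^sup>2"

definition generalized_ADMM ::
    "(real^'x::finite \<Rightarrow> real) \<Rightarrow> real^'x^'c::finite \<Rightarrow> real^'z::finite^'c \<Rightarrow> real \<Rightarrow> real \<Rightarrow> real^'x^'x \<Rightarrow>
     (nat \<Rightarrow> real^'x) \<Rightarrow> (nat \<Rightarrow> real^'z) \<Rightarrow> (nat \<Rightarrow> real^'c) \<Rightarrow> bool" where
  "generalized_ADMM F A B \<rho> \<eta> P x z l \<longleftrightarrow>
     (\<forall>k. is_arg_min (\<lambda>u. aug_lagrangian F A B \<rho> u (z k) (l k) + 1/2 * wnorm_sq P (u - x k))
            (\<lambda>_. True) (x (Suc k)) \<and>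
          is_arg_min (\<lambda>w. aug_lagrangian F A B \<rho> (x (Suc k)) w (l k)) (\<lambda>_. True) (z (Suc k)) \<and>
          l (Suc k) = l k + (\<eta> * \<rho>) *\<^sub>R (A *v x (Suc k) + B *v z (Suc k)))"

text \<open>Generalized ADMM for the consensus problem over the network.\<close>
definition network_ADMM ::
    "('n::finite, 'm::finite) pre_digraph \<Rightarrow> ('n \<Rightarrow> real^'p::finite \<Rightarrow> real) \<Rightarrow> real \<Rightarrow> real \<Rightarrow>
     real^('n \<times> 'p)^('n \<times> 'p) \<Rightarrow> (nat \<Rightarrow> real^('n \<times> 'p)) \<Rightarrow> (nat \<Rightarrow> real^('m \<times> 'p)) \<Rightarrow>
     (nat \<Rightarrow> real^('m \<times> 'p + 'm \<times> 'p)) \<Rightarrow> bool" where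
  "network_ADMM G f \<rho> \<eta> P x z l \<longleftrightarrow>
     generalized_ADMM (objective f) (stack (A_src G) (A_dst G)) (stack (- mat 1) (- mat 1))
       \<rho> \<eta> P x z l"

definition standard_init ::
    "('n::finite, 'm::finite) pre_digraph \<Rightarrow> real^('n \<times> 'p::finite) \<Rightarrow> real^('m \<times> 'p) \<Rightarrow>
     real^('m \<times> 'p + 'm \<times> 'p) \<Rightarrow> real^('m \<times> 'p) \<Rightarrow> bool" where
  "standard_init G x0 z0 l0 \<alpha>0 \<longleftrightarrow>
     l0 = stack \<alpha>0 (- \<alpha>0) \<and> \<alpha>0 \<in> range (\<lambda>y. E_o G *v y) \<and> E_u G *v x0 = 2 *\<^sub>R z0"

definition D_ADMM ::
    "('n::finite, 'm::finite) pre_digraph \<Rightarrow> ('n \<Rightarrow> real^'p::finite \<Rightarrow> real) \<Rightarrow> real \<Rightarrow> real \<Rightarrow>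
     real^('n \<times> 'p)^('n \<times> 'p) \<Rightarrow> (nat \<Rightarrow> real^('n \<times> 'p)) \<Rightarrow> (nat \<Rightarrow> real^('m \<times> 'p)) \<Rightarrow> bool" where
  "D_ADMM G f \<rho> \<eta> P x \<alpha> \<longleftrightarrow>
     (\<forall>k. is_arg_min
            (\<lambda>u. objective f u +
                 (transpose (E_o G) *v \<alpha> k -
                  (\<rho> / 2) *\<^sub>R (transpose (E_u G :: real^('n \<times> 'p)^('m \<times> 'p)) *v (E_u G *v x k))) \<bullet> u +
                 \<rho> / 2 * wnorm_sq (D_mat G) u + 1/2 * wnorm_sq P (u - x k))
            (\<lambda>_. True) (x (Suc k)) \<and>
          \<alpha> (Suc k) = \<alpha> k + (\<eta> * \<rho> / 2) *\<^sub>R (E_o G *v x (Suc k)))"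

definition P_EXTRA ::
    "(real^('n::finite \<times> 'p::finite) \<Rightarrow> real) \<Rightarrow> real \<Rightarrow> real^'n^'n \<Rightarrow> real^'n^'n \<Rightarrow>
     (nat \<Rightarrow> real^('n \<times> 'p)) \<Rightarrow> bool" where
  "P_EXTRA F \<xi> W Wt x \<longleftrightarrow>
     (\<forall>k. x (Suc k) = (W \<otimes>\<^sub>K mat 1) *v x k - \<xi> *\<^sub>R grad F (x (Suc k)) +
                      (\<Sum>t=0..k. ((W - Wt) \<otimes>\<^sub>K mat 1) *v x t))"

end

theory Submission
  imports Defs
begin

text \<open>
  The choice of \<open>Pi_mat\<close> is made so that \<open>\<rho> D + P = (1/\<xi>) I\<close>. Up to a constant, the objective of
  the \<open>x\<close>-step of generalized D-ADMM is therefore a convex differentiable function plus a linear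
  term plus an isotropic quadratic, whatever the sign of \<open>P\<close>, and its minimizers are exactly the
  zeros of its gradient (\<open>is_arg_min_convex_quadratic_iff\<close>). Because \<open>D\<close> is the mean of
  \<open>E\<^sub>o\<^sup>T E\<^sub>o\<close> and \<open>E\<^sub>u\<^sup>T E\<^sub>u\<close>, the term in \<open>E\<^sub>u\<close> cancels, and the
  optimality condition reads (\<open>D_ADMM_iff_recursion\<close>)

  \<open>x\<^sup>k\<^sup>+\<^sup>1 = x\<^sup>k - (\<xi>\<rho>/2) E\<^sub>o\<^sup>T E\<^sub>o x\<^sup>k - \<xi> \<nabla>f(x\<^sup>k\<^sup>+\<^sup>1) - \<xi> E\<^sub>o\<^sup>T \<alpha>\<^sup>k\<close>.

  Since \<open>E\<^sub>o\<^sup>T E\<^sub>o\<close> is \<open>L \<otimes> I\<close>, P-EXTRA is the same recursion with \<open>\<alpha>\<^sup>k\<close> replaced by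
  \<open>(\<eta>\<rho>/2) \<Sum>\<^sub>t\<^sub>\<le>\<^sub>k E\<^sub>o x\<^sup>t\<close> (\<open>P_EXTRA_iff_recursion\<close>). The dual
  update makes \<open>\<alpha>\<^sup>k\<close> differ from that sum by the constant
  \<open>\<alpha>\<^sup>0 - (\<eta>\<rho>/2) E\<^sub>o x\<^sup>0\<close>, so the two recursions agree iff \<open>E\<^sub>o\<^sup>T\<close> kills this
  constant. For \<open>\<alpha>\<^sup>0\<close> in the column space of \<open>E\<^sub>o\<close> this means that the constant is zero,
  because the kernel of \<open>E\<^sub>o\<^sup>T\<close> is orthogonal to that space.

  For generalized ADMM itself, the standard initialization is an invariant: as long as
  \<open>\<lambda>\<^sup>k = [\<alpha>\<^sup>k; -\<alpha>\<^sup>k]\<close>, completing the square in \<open>z\<close> (\<open>aug_lagrangian_network\<close>) shows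
  that the \<open>z\<close>-step has the unique solution \<open>z = E\<^sub>u x / 2\<close>, that the \<open>x\<close>-step is the one of D-ADMM
  up to a constant, and that the multiplier update keeps the antisymmetric form. Runs of
  the two methods thus correspond to each other (\<open>network_ADMM_iff_D_ADMM\<close>).
\<close>

section \<open>Optimality conditions\<close>

lemma convex_on_ge_tangent:
  fixes F :: "'a::real_inner \<Rightarrow> real"
  assumes conv: "convex_on UNIV F" and grd: "GDERIV F x :> g"
  shows "F x + g \<bullet> (y - x) \<le> F y"
proof -
  \<comment> \<open>The restriction to the line through \<open>x\<close> and \<open>y\<close> reduces this to one dimension.\<close>
  define \<phi> where "\<phi> t = F (x + t *\<^sub>R (y - x))" for t :: real
  have "convex_on UNIV \<phi>"
  proof (rule convex_onI)
    fix t a b :: real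
    assume "0 < t" "t < 1"
    have "x + ((1 - t) *\<^sub>R a + t *\<^sub>R b) *\<^sub>R (y - x) =
        (1 - t) *\<^sub>R (x + a *\<^sub>R (y - x)) + t *\<^sub>R (x + b *\<^sub>R (y - x))"
      by (simp add: algebra_simps)
    with \<open>0 < t\<close> \<open>t < 1\<close> show "\<phi> ((1 - t) *\<^sub>R a + t *\<^sub>R b) \<le> (1 - t) * \<phi> a + t * \<phi> b"
      unfolding \<phi>_def using convex_onD[OF conv] by simp
  qed simp
  moreover have "(\<phi> has_field_derivative g \<bullet> (y - x)) (at 0 within UNIV)"
  proof -
    have line: "((\<lambda>t. x + t *\<^sub>R (y - x)) has_derivative (\<lambda>t. t *\<^sub>R (y - x))) (at 0)"
      by (auto intro!: derivative_eq_intros)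
    have "(F has_derivative (\<lambda>h. h \<bullet> g)) (at (x + 0 *\<^sub>R (y - x)))"
      using grd by (simp add: gderiv_def)
    from has_derivative_compose[OF line this]
    show ?thesis
      unfolding \<phi>_def has_field_derivative_def by (simp add: mult_commute_abs inner_commute[of _ g])
  qed
  ultimately have "\<phi> 1 - \<phi> 0 \<ge> (g \<bullet> (y - x)) * (1 - 0)"
    by (intro convex_on_imp_above_tangent[where A = UNIV]) auto
  then show ?thesis
    by (simp add: \<phi>_def)
qed

text \<open>
  The first summand lies above its tangents by convexity, and the quadratic does so by direct
  computation.
\<close>
lemma is_arg_min_convex_quadratic_iff:
  fixes F :: "'a::real_inner \<Rightarrow> real"
  assumes conv: "convex_on UNIV F" and grd: "GDERIV F x :> g" and "q \<ge> 0"
  shows "is_arg_min (\<lambda>u. F u + b \<bullet> u + q / 2 * (u \<bullet> u)) (\<lambda>_. True) x \<longleftrightarrow> g + b + q *\<^sub>R x = 0"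
    (is "is_arg_min ?H _ x \<longleftrightarrow> _")
proof
  assume min: "is_arg_min ?H (\<lambda>_. True) x"
  have "(?H has_derivative (\<lambda>h. h \<bullet> (g + b + q *\<^sub>R x))) (at x)"
    using grd unfolding gderiv_def
    by (auto intro!: derivative_eq_intros simp: algebra_simps inner_commute)
  moreover have "\<forall>y\<in>UNIV. ?H x \<le> ?H y"
    using min by (auto simp: is_arg_min_def not_less)
  ultimately have "(\<lambda>h. h \<bullet> (g + b + q *\<^sub>R x)) = (\<lambda>h. 0)"
    by (intro differential_zero_maxmin[where S = UNIV]) auto
  then show "g + b + q *\<^sub>R x = 0"
    by (metis inner_eq_zero_iff)
next
  assume "g + b + q *\<^sub>R x = 0"
  then have g: "g = - b - q *\<^sub>R x"
    by (simp add: eq_neg_iff_add_eq_0 algebra_simps)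
  have "?H x \<le> ?H y" for y
  proof -
    have "0 \<le> q / 2 * ((y - x) \<bullet> (y - x))"
      using \<open>q \<ge> 0\<close> by simp
    then show ?thesis
      using convex_on_ge_tangent[OF conv grd, of y]
      by (simp add: g algebra_simps inner_commute)
  qed
  then show "is_arg_min ?H (\<lambda>_. True) x"
    by (simp add: is_arg_min_def not_less)
qed

lemma is_arg_min_add_const:
  fixes f g :: "'a \<Rightarrow> real"
  assumes "\<And>u. f u = g u + c"
  shows "is_arg_min f Q x \<longleftrightarrow> is_arg_min g Q x"
  by (simp add: is_arg_min_def assms)

lemma is_arg_min_dist_sq_iff:
  fixes c :: "'a::real_inner"
  assumes "\<rho> > 0"
  shows "is_arg_min (\<lambda>w. a + \<rho> * (norm (w - c))\<^sup>2) (\<lambda>_. True) w \<longleftrightarrow> w = c"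
proof
  assume "is_arg_min (\<lambda>w. a + \<rho> * (norm (w - c))\<^sup>2) (\<lambda>_. True) w"
  then have "\<not> a + \<rho> * (norm (c - c))\<^sup>2 < a + \<rho> * (norm (w - c))\<^sup>2"
    unfolding is_arg_min_def by blast
  with assms show "w = c"
    by (simp add: zero_less_mult_iff)
next
  assume "w = c"
  with assms show "is_arg_min (\<lambda>w. a + \<rho> * (norm (w - c))\<^sup>2) (\<lambda>_. True) w"
    by (simp add: is_arg_min_def not_less)
qed

lemma linear_block: "linear (\<lambda>x. block x i)"
  by (intro linearI) (simp_all add: block_def vec_eq_iff)

lemma convex_on_objective:
  assumes "\<And>i. convex_on UNIV (f i)"
  shows "convex_on UNIV (objective f)"
proof (rule convex_onI)
  fix t :: real and x y :: "real^('a \<times> 'b)"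
  assume t: "0 < t" "t < 1"
  have "f i (block ((1 - t) *\<^sub>R x + t *\<^sub>R y) i) \<le>
      (1 - t) * f i (block x i) + t * f i (block y i)" for i
    using t convex_onD[OF assms[of i], of t "block x i" "block y i"]
    by (simp add: linear_add[OF linear_block] linear_cmul[OF linear_block])
  then show "objective f ((1 - t) *\<^sub>R x + t *\<^sub>R y) \<le> (1 - t) * objective f x + t * objective f y"
    unfolding objective_def sum_distrib_left sum.distrib[symmetric] by (intro sum_mono)
qed simp

lemma differentiable_objective:
  fixes f :: "'n::finite \<Rightarrow> real^'p::finite \<Rightarrow> real"
  assumes "\<And>i y. f i differentiable (at y)"
  shows "objective f differentiable (at x)"
proof -
  have "(\<lambda>x. f i (block x i)) differentiable (at x)" for i
    using differentiable_compose[OF assms linear_imp_differentiable[OF linear_block]] .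
  then show ?thesis
    unfolding objective_def by (intro differentiable_sum) auto
qed

section \<open>Matrix algebra\<close>

lemma kron_scaleR: "(c *\<^sub>R M) \<otimes>\<^sub>K N = c *\<^sub>R (M \<otimes>\<^sub>K N)"
  by (simp add: kron_def vec_eq_iff)

lemma kron_mat_1: "mat 1 \<otimes>\<^sub>K mat 1 = mat 1"
  by (auto simp: kron_def vec_eq_iff mat_def prod_eq_iff)

lemma inner_transpose_vector:
  fixes M :: "real^'a::finite^'b::finite"
  shows "(transpose M *v y) \<bullet> x = y \<bullet> (M *v x)"
  by (simp add: transpose_matrix_vector dot_lmul_matrix)

lemma inner_vector_transpose:
  fixes M :: "real^'a::finite^'b::finite"
  shows "x \<bullet> (transpose M *v y) = (M *v x) \<bullet> y"
  using inner_transpose_vector[of M y x] by (simp only: inner_commute)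

lemma inner_stack:
  "stack u v \<bullet> stack u' v' = u \<bullet> u' + (v :: real^'s::finite) \<bullet> v'"
  by (simp add: inner_vec_def stack_def UNIV_Plus_UNIV[symmetric] sum.Plus del: UNIV_Plus_UNIV)

lemma norm_stack_sq:
  "(norm (stack u (v :: real^'s::finite)))\<^sup>2 = (norm u)\<^sup>2 + (norm v)\<^sup>2"
  by (simp add: power2_norm_eq_inner inner_stack)

lemma stack_mult_vector: "stack M N *v x = stack (M *v x) (N *v x)"
  by (auto simp: stack_def matrix_vector_mult_def vec_eq_iff split: sum.split)

lemma stack_add: "stack u v + stack u' v' = stack (u + u') (v + v')"
  by (auto simp: stack_def vec_eq_iff split: sum.split)

lemma scaleR_stack: "c *\<^sub>R stack u v = stack (c *\<^sub>R u) (c *\<^sub>R v)"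
  by (auto simp: stack_def vec_eq_iff split: sum.split)

lemma uminus_mat_1_vector: "- mat 1 *v x = - (x :: real^'a::finite)"
  using matrix_vector_mult_diff_rdistrib[of 0 "mat 1" x] by simp

text \<open>The kernel of a transposed matrix is orthogonal to the column space of the matrix.\<close>
lemma transpose_vector_eq_0_imp:
  fixes M :: "real^'a::finite^'b::finite"
  assumes "transpose M *v v = 0" and "v \<in> range (\<lambda>y. M *v y)"
  shows "v = 0"
proof -
  obtain y where y: "v = M *v y"
    using assms(2) by blast
  have "v \<bullet> v = (transpose M *v v) \<bullet> y"
    by (simp only: inner_transpose_vector flip: y)
  with assms(1) show ?thesis
    by simp
qed

lemma diagonal_matrix_quadratic_form:
  assumes "diagonal_matrix S"
  shows "x \<bullet> (S *v x) = (\<Sum>i\<in>UNIV. S $ i $ i * (x $ i)\<^sup>2)"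
proof -
  have "(\<Sum>j\<in>UNIV. S $ i $ j * x $ j) = S $ i $ i * x $ i" for i
    using assms sum.remove[of UNIV i "\<lambda>j. S $ i $ j * x $ j"]
    by (simp add: diagonal_matrix_def)
  then show ?thesis
    by (simp add: inner_vec_def matrix_vector_mult_def power2_eq_square mult_ac)
qed

lemma pos_semidef_diagonal_iff:
  assumes diag: "diagonal_matrix S"
  shows "pos_semidef S \<longleftrightarrow> (\<forall>i. 0 \<le> S $ i $ i)"
proof
  assume psd: "pos_semidef S"
  show "\<forall>i. 0 \<le> S $ i $ i"
  proof
    fix i
    have "axis i 1 \<bullet> (S *v axis i 1) = S $ i $ i"
      by (simp add: inner_axis' matrix_vector_mul_component inner_axis)
    with psd show "0 \<le> S $ i $ i"
      by (metis pos_semidef_def)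
  qed
next
  assume "\<forall>i. 0 \<le> S $ i $ i"
  moreover have "S $ i $ j = S $ j $ i" for i j
    using diag by (cases "i = j") (simp_all add: diagonal_matrix_def)
  ultimately show "pos_semidef S"
    by (simp add: pos_semidef_def diagonal_matrix_quadratic_form[OF diag] transpose_def
        vec_eq_iff sum_nonneg)
qed

section \<open>Admissible penalties\<close>

lemma diagonal_proximal_matrix:
  "diagonal_matrix ((1 / s) *\<^sub>R (mat 1 - (s * r) *\<^sub>R degree_matrix G))"
  by (simp add: diagonal_matrix_def degree_matrix_def mat_def)

lemma pos_semidef_proximal_matrix_iff:
  assumes "s > 0"
  shows "pos_semidef ((1 / s) *\<^sub>R (mat 1 - (s * r) *\<^sub>R degree_matrix G)) \<longleftrightarrow>
      (\<forall>i. s * r * degree_matrix G $ i $ i \<le> 1)"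
  unfolding pos_semidef_diagonal_iff[OF diagonal_proximal_matrix]
  using assms by (simp add: mat_def zero_le_divide_iff)

text \<open>
  The condition on step-size and penalty involves only their product, so each of the two can
  be chosen small enough for any value of the other.
\<close>
lemma ex_small_product:
  fixes d :: "'n::finite \<Rightarrow> real"
  assumes "\<And>i. 0 \<le> d i" and "r > 0"
  shows "\<exists>s0>0. \<forall>s. 0 < s \<and> s \<le> s0 \<longrightarrow> (\<forall>i. s * r * d i \<le> 1)"
proof -
  \<comment> \<open>The sum bounds every \<open>d i\<close>; the summand 1 keeps it positive.\<close>
  define K where "K = 1 + (\<Sum>i\<in>UNIV. d i)"
  have K: "d i \<le> K" for i
  proof -
    have "d i \<le> (\<Sum>i\<in>UNIV. d i)"
      by (intro member_le_sum) (auto intro: assms(1))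
    then show ?thesis
      by (simp add: K_def)
  qed
  have "0 \<le> (\<Sum>i\<in>UNIV. d i)"
    by (intro sum_nonneg assms(1))
  then have "K > 0"
    by (simp add: K_def)
  have "s * r * d i \<le> 1" if s: "0 < s" "s \<le> 1 / (r * K)" for s i
  proof -
    have "s * r * d i \<le> s * r * K"
      using s K \<open>r > 0\<close> by (intro mult_left_mono) auto
    also have "\<dots> \<le> 1"
      using s \<open>r > 0\<close> \<open>K > 0\<close> by (simp add: field_simps)
    finally show ?thesis .
  qed
  moreover have "1 / (r * K) > 0"
    using \<open>r > 0\<close> \<open>K > 0\<close> by simp
  ultimately show ?thesis
    by blast
qed

lemma ex_pos_semidef_proximal_matrix:
  assumes "r > 0"
  shows "\<exists>s0>0. \<forall>s. 0 < s \<and> s \<le> s0 \<longrightarrow>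
      pos_semidef ((1 / s) *\<^sub>R (mat 1 - (s * r) *\<^sub>R degree_matrix G))"
    and "\<exists>s0>0. \<forall>s. 0 < s \<and> s \<le> s0 \<longrightarrow>
      pos_semidef ((1 / r) *\<^sub>R (mat 1 - (r * s) *\<^sub>R degree_matrix G))"
proof -
  have "0 \<le> degree_matrix G $ i $ i" for i
    by (simp add: degree_matrix_def)
  from ex_small_product[where d = "\<lambda>i. degree_matrix G $ i $ i", OF this assms]
  obtain s0 where "s0 > 0"
    and s0: "\<And>s i. 0 < s \<and> s \<le> s0 \<Longrightarrow> s * r * degree_matrix G $ i $ i \<le> 1"
    by blast
  have "pos_semidef ((1 / s) *\<^sub>R (mat 1 - (s * r) *\<^sub>R degree_matrix G))"
    if s: "0 < s \<and> s \<le> s0" for s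
    unfolding pos_semidef_proximal_matrix_iff[OF conjunct1[OF s]] using s0[OF s] ..
  with \<open>s0 > 0\<close> show "\<exists>s0>0. \<forall>s. 0 < s \<and> s \<le> s0 \<longrightarrow>
      pos_semidef ((1 / s) *\<^sub>R (mat 1 - (s * r) *\<^sub>R degree_matrix G))"
    by blast
  have "pos_semidef ((1 / r) *\<^sub>R (mat 1 - (r * s) *\<^sub>R degree_matrix G))"
    if s: "0 < s \<and> s \<le> s0" for s
    unfolding pos_semidef_proximal_matrix_iff[OF assms]
    using s0[OF s, unfolded mult.commute[of s r]] ..
  with \<open>s0 > 0\<close> show "\<exists>s0>0. \<forall>s. 0 < s \<and> s \<le> s0 \<longrightarrow>
      pos_semidef ((1 / r) *\<^sub>R (mat 1 - (r * s) *\<^sub>R degree_matrix G))"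
    by blast
qed

section \<open>Generalized D-ADMM and P-EXTRA\<close>

lemma D_mat_mult_vector:
  fixes G :: "('n::finite, 'm::finite) pre_digraph" and x :: "real^('n \<times> 'p::finite)"
  shows "D_mat G *v x =
      (1 / 2) *\<^sub>R (transpose (E_o G :: real^('n \<times> 'p)^('m \<times> 'p)) *v (E_o G *v x) +
                 transpose (E_u G :: real^('n \<times> 'p)^('m \<times> 'p)) *v (E_u G *v x))"
  by (simp add: D_mat_def matrix_vector_mult_add_rdistrib scaleR_matrix_vector_assoc[symmetric]
      matrix_vector_mul_assoc)

lemma inner_D_mat:
  fixes G :: "('n::finite, 'm::finite) pre_digraph" and x :: "real^('n \<times> 'p::finite)"
  shows "x \<bullet> (D_mat G *v y) =
      1 / 2 * ((E_o G *v x) \<bullet> (E_o G *v y :: real^('m \<times> 'p)) +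
               (E_u G *v x) \<bullet> (E_u G *v y :: real^('m \<times> 'p)))"
  by (simp only: D_mat_mult_vector inner_scaleR_right inner_add_right inner_vector_transpose)

text \<open>
  For this proximal term the quadratic parts of the \<open>x\<close>-step add up to \<open>(1/\<xi>) I\<close>, so the
  problem is strongly convex even when \<open>P\<close> is indefinite, and its optimality condition can be
  solved for the linear occurrence of the new iterate.
\<close>
lemma D_ADMM_iff_recursion:
  fixes G :: "('n::finite, 'm::finite) pre_digraph"
    and f :: "'n \<Rightarrow> real^'p::finite \<Rightarrow> real"
    and \<alpha> :: "nat \<Rightarrow> real^('m \<times> 'p)"
  assumes conv: "\<And>i. convex_on UNIV (f i)"
    and diff: "\<And>i y. f i differentiable (at y)"
    and "\<xi> > 0"
    and P: "P = (1 / \<xi>) *\<^sub>R mat 1 - \<rho> *\<^sub>R D_mat G"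
  shows "D_ADMM G f \<rho> \<eta> P x \<alpha> \<longleftrightarrow>
      (\<forall>k. x (Suc k) = x k - (\<xi> * \<rho> / 2) *\<^sub>R (transpose (E_o G) *v (E_o G *v x k :: real^('m \<times> 'p)))
              - \<xi> *\<^sub>R grad (objective f) (x (Suc k)) - \<xi> *\<^sub>R (transpose (E_o G) *v \<alpha> k) \<and>
           \<alpha> (Suc k) = \<alpha> k + (\<eta> * \<rho> / 2) *\<^sub>R (E_o G *v x (Suc k)))"
proof -
  let ?Eo = "E_o G :: real^('n \<times> 'p)^('m \<times> 'p)"
  let ?Eu = "E_u G :: real^('n \<times> 'p)^('m \<times> 'p)"
  have Pv: "P *v v = (1 / \<xi>) *\<^sub>R v - \<rho> *\<^sub>R (D_mat G *v v)" for v
    by (simp add: P matrix_vector_mult_diff_rdistrib scaleR_matrix_vector_assoc[symmetric])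
  have sym: "u \<bullet> (D_mat G *v v) = v \<bullet> (D_mat G *v u)" for u v :: "real^('n \<times> 'p)"
    by (simp add: inner_D_mat inner_commute)
  have step: "is_arg_min
      (\<lambda>u. objective f u + (transpose ?Eo *v a - (\<rho> / 2) *\<^sub>R (transpose ?Eu *v (?Eu *v v))) \<bullet> u +
           \<rho> / 2 * wnorm_sq (D_mat G) u + 1/2 * wnorm_sq P (u - v)) (\<lambda>_. True) w \<longleftrightarrow>
      w = v - (\<xi> * \<rho> / 2) *\<^sub>R (transpose ?Eo *v (?Eo *v v))
            - \<xi> *\<^sub>R grad (objective f) w - \<xi> *\<^sub>R (transpose ?Eo *v a)"
    (is "is_arg_min ?J _ _ \<longleftrightarrow> _") for a v w
  proof -
    let ?g = "grad (objective f) w"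
    define b where "b = transpose ?Eo *v a - (\<rho> / 2) *\<^sub>R (transpose ?Eu *v (?Eu *v v)) - P *v v"
    have "?J u = (objective f u + b \<bullet> u + (1 / \<xi>) / 2 * (u \<bullet> u)) + 1/2 * (v \<bullet> (P *v v))" for u
      using \<open>\<xi> > 0\<close>
      by (simp add: b_def wnorm_sq_def Pv matrix_vector_mult_diff_distrib scaleR_diff_right
          inner_diff_left inner_diff_right sym[of v u] inner_commute[of v u]
          inner_commute[of "D_mat G *v v" u])
         (simp add: field_simps)
    then have "is_arg_min ?J (\<lambda>_. True) w \<longleftrightarrow>
        is_arg_min (\<lambda>u. objective f u + b \<bullet> u + (1 / \<xi>) / 2 * (u \<bullet> u)) (\<lambda>_. True) w"
      by (rule is_arg_min_add_const)
    also have "\<dots> \<longleftrightarrow> ?g + b + (1 / \<xi>) *\<^sub>R w = 0"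
      using \<open>\<xi> > 0\<close> GDERIV_grad[OF differentiable_objective[OF diff]]
      by (intro is_arg_min_convex_quadratic_iff convex_on_objective conv) auto
    also have "\<dots> \<longleftrightarrow> \<xi> *\<^sub>R (?g + b + (1 / \<xi>) *\<^sub>R w) = 0"
      using \<open>\<xi> > 0\<close> by simp
    also have "\<xi> *\<^sub>R (?g + b + (1 / \<xi>) *\<^sub>R w) =
        w - (v - (\<xi> * \<rho> / 2) *\<^sub>R (transpose ?Eo *v (?Eo *v v)) - \<xi> *\<^sub>R ?g - \<xi> *\<^sub>R (transpose ?Eo *v a))"
      using \<open>\<xi> > 0\<close> by (simp add: b_def Pv D_mat_mult_vector algebra_simps)
    finally show ?thesis
      by (simp only: right_minus_eq)
  qed
  show ?thesis
    unfolding D_ADMM_def step ..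
qed

lemma P_EXTRA_iff_recursion:
  fixes G :: "('n::finite, 'm::finite) pre_digraph"
    and x :: "nat \<Rightarrow> real^('n \<times> 'p::finite)"
  assumes net: "network G"
    and W: "W = mat 1 - (\<xi> * \<rho> / 2) *\<^sub>R laplacian G"
    and Wt: "Wt = mat 1 - (\<xi> * \<rho> / 2 * (1 - \<eta>)) *\<^sub>R laplacian G"
  shows "P_EXTRA F \<xi> W Wt x \<longleftrightarrow>
      (\<forall>k. x (Suc k) = x k - (\<xi> * \<rho> / 2) *\<^sub>R (transpose (E_o G) *v (E_o G *v x k :: real^('m \<times> 'p)))
              - \<xi> *\<^sub>R grad F (x (Suc k))
              - \<xi> *\<^sub>R (transpose (E_o G) *v
                  ((\<eta> * \<rho> / 2) *\<^sub>R (\<Sum>t\<le>k. E_o G *v x t) :: real^('m \<times> 'p))))"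
proof -
  let ?Eo = "E_o G :: real^('n \<times> 'p)^('m \<times> 'p)"
  have L: "(laplacian G \<otimes>\<^sub>K (mat 1 :: real^'p^'p)) *v v = transpose ?Eo *v (?Eo *v v)" for v
    by (simp add: matrix_vector_mul_assoc E_o_gram_eq_kron[OF net])
  have Wv: "(W \<otimes>\<^sub>K (mat 1 :: real^'p^'p)) *v v =
      v - (\<xi> * \<rho> / 2) *\<^sub>R (transpose ?Eo *v (?Eo *v v))" for v
    by (simp add: W kron_diff kron_scaleR kron_mat_1 matrix_vector_mult_diff_rdistrib
        scaleR_matrix_vector_assoc[symmetric] L)
  have "W - Wt = (- (\<xi> * \<rho> / 2 * \<eta>)) *\<^sub>R laplacian G"
    by (simp add: W Wt vec_eq_iff field_simps)
  then have WWt: "((W - Wt) \<otimes>\<^sub>K (mat 1 :: real^'p^'p)) *v v =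
      (- (\<xi> * \<rho> / 2 * \<eta>)) *\<^sub>R (transpose ?Eo *v (?Eo *v v))" for v
    by (simp only: kron_scaleR scaleR_matrix_vector_assoc[symmetric] L)
  have "(\<Sum>t=0..k. ((W - Wt) \<otimes>\<^sub>K mat 1) *v x t) =
      - (\<xi> *\<^sub>R (transpose ?Eo *v ((\<eta> * \<rho> / 2) *\<^sub>R (\<Sum>t\<le>k. ?Eo *v x t))))" for k
    unfolding WWt atLeast0AtMost
    by (simp add: sum_negf scaleR_sum_right matrix_vector_mult_scaleR
        linear_sum[OF matrix_vector_mul_linear] mult_ac)
  then show ?thesis
    unfolding P_EXTRA_def Wv by (simp add: algebra_simps)
qed

lemma dual_update_sum:
  fixes \<alpha> :: "nat \<Rightarrow> 'a::real_vector"
  assumes "\<And>k. \<alpha> (Suc k) = \<alpha> k + c *\<^sub>R y (Suc k)"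
  shows "\<alpha> k = c *\<^sub>R (\<Sum>t\<le>k. y t) + (\<alpha> 0 - c *\<^sub>R y 0)"
  by (induction k) (simp_all add: assms algebra_simps)

text \<open>
  The dual variable and the running sum behind the memory term of P-EXTRA differ by the same
  vector at all times. That vector lies in the column space of \<open>E\<^sub>o\<close>, where \<open>E\<^sub>o\<^sup>T\<close> is injective.
\<close>
lemma D_ADMM_P_EXTRA_iff:
  fixes G :: "('n::finite, 'm::finite) pre_digraph"
    and f :: "'n \<Rightarrow> real^'p::finite \<Rightarrow> real"
    and \<alpha> :: "nat \<Rightarrow> real^('m \<times> 'p)"
  assumes net: "network G"
    and conv: "\<And>i. convex_on UNIV (f i)"
    and diff: "\<And>i y. f i differentiable (at y)"
    and "\<xi> > 0"
    and P: "P = (1 / \<xi>) *\<^sub>R mat 1 - \<rho> *\<^sub>R D_mat G"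
    and W: "W = mat 1 - (\<xi> * \<rho> / 2) *\<^sub>R laplacian G"
    and Wt: "Wt = mat 1 - (\<xi> * \<rho> / 2 * (1 - \<eta>)) *\<^sub>R laplacian G"
    and rng: "\<alpha> 0 \<in> range (\<lambda>y. E_o G *v y)"
    and run: "D_ADMM G f \<rho> \<eta> P x \<alpha>"
  shows "P_EXTRA (objective f) \<xi> W Wt x \<longleftrightarrow> \<alpha> 0 = (\<eta> * \<rho> / 2) *\<^sub>R (E_o G *v x 0)"
proof -
  let ?Eo = "E_o G :: real^('n \<times> 'p)^('m \<times> 'p)"
  define c where "c = \<eta> * \<rho> / 2"
  define e where "e = \<alpha> 0 - c *\<^sub>R (?Eo *v x 0)"
  note rec = run[unfolded D_ADMM_iff_recursion[OF conv diff \<open>\<xi> > 0\<close> P], rule_format]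
  have \<alpha>: "\<alpha> k = c *\<^sub>R (\<Sum>t\<le>k. ?Eo *v x t) + e" for k
    unfolding e_def c_def using rec by (intro dual_update_sum) auto
  have "P_EXTRA (objective f) \<xi> W Wt x \<longleftrightarrow>
      (\<forall>k. transpose ?Eo *v \<alpha> k = transpose ?Eo *v (c *\<^sub>R (\<Sum>t\<le>k. ?Eo *v x t)))"
    unfolding P_EXTRA_iff_recursion[OF net W Wt] c_def[symmetric]
  proof (rule all_cong1)
    \<comment> \<open>Both recursions express \<open>x (Suc k)\<close> through itself by formulas that differ in a single
       term, so given one of them the other holds iff these terms agree.\<close>
    have "(y = p - \<xi> *\<^sub>R b) \<longleftrightarrow> a = b" if "y = p - \<xi> *\<^sub>R a" for y p a b :: "real^('n \<times> 'p)"
      using that \<open>\<xi> > 0\<close> by auto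
    from this[OF conjunct1[OF rec]]
    show "(x (Suc k) = x k - (\<xi> * \<rho> / 2) *\<^sub>R (transpose ?Eo *v (?Eo *v x k))
          - \<xi> *\<^sub>R grad (objective f) (x (Suc k))
          - \<xi> *\<^sub>R (transpose ?Eo *v (c *\<^sub>R (\<Sum>t\<le>k. ?Eo *v x t)))) \<longleftrightarrow>
        transpose ?Eo *v \<alpha> k = transpose ?Eo *v (c *\<^sub>R (\<Sum>t\<le>k. ?Eo *v x t))" for k .
  qed
  also have "\<dots> \<longleftrightarrow> transpose ?Eo *v e = 0"
    by (simp add: \<alpha> matrix_vector_right_distrib)
  also have "\<dots> \<longleftrightarrow> e = 0"
  proof -
    obtain y where "\<alpha> 0 = ?Eo *v y"
      using rng by blast
    then have "e = ?Eo *v (y - c *\<^sub>R x 0)"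
      by (simp add: e_def matrix_vector_mult_diff_distrib matrix_vector_mult_scaleR)
    then show ?thesis
      using transpose_vector_eq_0_imp[of ?Eo e] by auto
  qed
  finally show ?thesis
    by (simp add: e_def c_def)
qed

lemma P_EXTRA_imp_ex_D_ADMM:
  fixes G :: "('n::finite, 'm::finite) pre_digraph"
    and f :: "'n \<Rightarrow> real^'p::finite \<Rightarrow> real"
  assumes net: "network G"
    and conv: "\<And>i. convex_on UNIV (f i)"
    and diff: "\<And>i y. f i differentiable (at y)"
    and "\<xi> > 0"
    and P: "P = (1 / \<xi>) *\<^sub>R mat 1 - \<rho> *\<^sub>R D_mat G"
    and W: "W = mat 1 - (\<xi> * \<rho> / 2) *\<^sub>R laplacian G"
    and Wt: "Wt = mat 1 - (\<xi> * \<rho> / 2 * (1 - \<eta>)) *\<^sub>R laplacian G"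
    and run: "P_EXTRA (objective f) \<xi> W Wt x"
  shows "\<exists>\<alpha> :: nat \<Rightarrow> real^('m \<times> 'p). \<alpha> 0 \<in> range (\<lambda>y. E_o G *v y) \<and> D_ADMM G f \<rho> \<eta> P x \<alpha>"
proof -
  let ?Eo = "E_o G :: real^('n \<times> 'p)^('m \<times> 'p)"
  define \<alpha> where "\<alpha> k = (\<eta> * \<rho> / 2) *\<^sub>R (\<Sum>t\<le>k. ?Eo *v x t)" for k
  have "\<alpha> 0 = ?Eo *v ((\<eta> * \<rho> / 2) *\<^sub>R x 0)"
    by (simp add: \<alpha>_def matrix_vector_mult_scaleR)
  moreover have "D_ADMM G f \<rho> \<eta> P x \<alpha>"
    unfolding D_ADMM_iff_recursion[OF conv diff \<open>\<xi> > 0\<close> P]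
  proof (intro allI conjI)
    fix k
    show "x (Suc k) = x k - (\<xi> * \<rho> / 2) *\<^sub>R (transpose ?Eo *v (?Eo *v x k))
        - \<xi> *\<^sub>R grad (objective f) (x (Suc k)) - \<xi> *\<^sub>R (transpose ?Eo *v \<alpha> k)"
      unfolding \<alpha>_def using run[unfolded P_EXTRA_iff_recursion[OF net W Wt]] ..
    show "\<alpha> (Suc k) = \<alpha> k + (\<eta> * \<rho> / 2) *\<^sub>R (?Eo *v x (Suc k))"
      by (simp add: \<alpha>_def scaleR_add_right)
  qed
  ultimately show ?thesis
    by blast
qed

section \<open>Reduction of generalized ADMM to D-ADMM\<close>

text \<open>
  For an antisymmetric multiplier the linear term does not involve \<open>z\<close>, because \<open>z\<close> enters both
  constraint blocks in the same way. The rest is the identity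
  \<open>\<parallel>a - w\<parallel>\<^sup>2 + \<parallel>b - w\<parallel>\<^sup>2 = 2 \<parallel>w - (a + b)/2\<parallel>\<^sup>2 + \<parallel>a - b\<parallel>\<^sup>2 / 2\<close>.
\<close>
lemma aug_lagrangian_network:
  fixes G :: "('n::finite, 'm::finite) pre_digraph"
    and u :: "real^('n \<times> 'p::finite)" and a w :: "real^('m \<times> 'p)"
  shows "aug_lagrangian F (stack (A_src G) (A_dst G)) (stack (- mat 1) (- mat 1)) \<rho> u w (stack a (- a)) =
      F u + a \<bullet> (E_o G *v u) + \<rho> / 4 * (norm (E_o G *v u :: real^('m \<times> 'p)))\<^sup>2 +
      \<rho> * (norm (w - (1 / 2) *\<^sub>R (E_u G *v u)))\<^sup>2"
proof -
  define s where "s = (A_src G :: real^('n \<times> 'p)^('m \<times> 'p)) *v u"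
  define d where "d = (A_dst G :: real^('n \<times> 'p)^('m \<times> 'p)) *v u"
  have E: "E_o G *v u = s - d" "E_u G *v u = s + d"
    by (simp_all add: E_o_def E_u_def s_def d_def matrix_vector_mult_diff_rdistrib
        matrix_vector_mult_add_rdistrib)
  have res: "stack (A_src G) (A_dst G) *v u + stack (- mat 1) (- mat 1) *v w = stack (s - w) (d - w)"
    by (simp add: stack_mult_vector stack_add uminus_mat_1_vector s_def d_def)
  have "(norm (s - w))\<^sup>2 + (norm (d - w))\<^sup>2 =
      2 * (norm (w - (1 / 2) *\<^sub>R (s + d)))\<^sup>2 + 1 / 2 * (norm (s - d))\<^sup>2"
    by (simp add: power2_norm_eq_inner algebra_simps inner_commute)
  then have "\<rho> / 2 * ((norm (s - w))\<^sup>2 + (norm (d - w))\<^sup>2) =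
      \<rho> / 4 * (norm (s - d))\<^sup>2 + \<rho> * (norm (w - (1 / 2) *\<^sub>R (s + d)))\<^sup>2"
    by (simp add: algebra_simps)
  then show ?thesis
    by (simp add: aug_lagrangian_def res inner_stack norm_stack_sq E inner_diff_right)
qed

lemma stack_residual_half:
  fixes G :: "('n::finite, 'm::finite) pre_digraph" and u :: "real^('n \<times> 'p::finite)"
  shows "stack (A_src G) (A_dst G) *v u +
        stack (- mat 1) (- mat 1) *v ((1 / 2) *\<^sub>R (E_u G *v u)) =
      (1 / 2) *\<^sub>R stack (E_o G *v u) (- (E_o G *v u) :: real^('m \<times> 'p))"
proof -
  have "a - (1 / 2) *\<^sub>R (a + b) = (1 / 2) *\<^sub>R (a - b)"
       "b - (1 / 2) *\<^sub>R (a + b) = (1 / 2) *\<^sub>R (- (a - b))" for a b :: "real^('m \<times> 'p)"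
    by (simp_all add: vec_eq_iff field_simps)
  then show ?thesis
    by (simp add: stack_mult_vector stack_add scaleR_stack uminus_mat_1_vector E_o_def E_u_def
        matrix_vector_mult_diff_rdistrib matrix_vector_mult_add_rdistrib)
qed

text \<open>
  The right-hand side describes every run: the auxiliary variable and the multiplier are
  functions of a run of D-ADMM.
\<close>
lemma network_ADMM_iff_D_ADMM:
  fixes G :: "('n::finite, 'm::finite) pre_digraph"
    and f :: "'n \<Rightarrow> real^'p::finite \<Rightarrow> real"
    and z :: "nat \<Rightarrow> real^('m \<times> 'p)"
  assumes "\<rho> > 0"
    and l0: "l 0 = stack \<alpha>0 (- \<alpha>0)" and z0: "z 0 = (1 / 2) *\<^sub>R (E_u G *v x 0)"
  shows "network_ADMM G f \<rho> \<eta> P x z l \<longleftrightarrow>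
      (\<exists>\<alpha>. \<alpha> 0 = \<alpha>0 \<and> D_ADMM G f \<rho> \<eta> P x \<alpha> \<and>
        (\<forall>k. z k = (1 / 2) *\<^sub>R (E_u G *v x k) \<and> l k = stack (\<alpha> k) (- \<alpha> k)))"
proof -
  let ?Eo = "E_o G :: real^('n \<times> 'p)^('m \<times> 'p)"
  let ?Eu = "E_u G :: real^('n \<times> 'p)^('m \<times> 'p)"
  let ?A = "stack (A_src G) (A_dst G) :: real^('n \<times> 'p)^('m \<times> 'p + 'm \<times> 'p)"
  let ?B = "stack (- mat 1) (- mat 1) :: real^('m \<times> 'p)^('m \<times> 'p + 'm \<times> 'p)"
  let ?L = "\<lambda>u w l. aug_lagrangian (objective f) ?A ?B \<rho> u w l"
  let ?J = "\<lambda>a v u. objective f u + (transpose ?Eo *v a - (\<rho> / 2) *\<^sub>R (transpose ?Eu *v (?Eu *v v))) \<bullet> u +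
           \<rho> / 2 * wnorm_sq (D_mat G) u + 1/2 * wnorm_sq P (u - v)"
  have x_step: "is_arg_min (\<lambda>u. ?L u ((1 / 2) *\<^sub>R (?Eu *v v)) (stack a (- a)) + 1/2 * wnorm_sq P (u - v))
      (\<lambda>_. True) w \<longleftrightarrow> is_arg_min (?J a v) (\<lambda>_. True) w" for a v w
  proof (rule is_arg_min_add_const)
    show "?L u ((1 / 2) *\<^sub>R (?Eu *v v)) (stack a (- a)) + 1/2 * wnorm_sq P (u - v) =
        ?J a v u + \<rho> / 4 * (norm (?Eu *v v))\<^sup>2" for u
      unfolding aug_lagrangian_network wnorm_sq_def[of "D_mat G"] inner_D_mat inner_diff_left
        inner_scaleR_left inner_transpose_vector power2_norm_eq_inner
      by (simp add: algebra_simps inner_commute)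
  qed
  have z_step: "is_arg_min (\<lambda>w. ?L u w (stack a (- a))) (\<lambda>_. True) w \<longleftrightarrow> w = (1 / 2) *\<^sub>R (?Eu *v u)"
    for u a w
    unfolding aug_lagrangian_network by (rule is_arg_min_dist_sq_iff) fact
  have l_step: "stack a (- a) + (\<eta> * \<rho>) *\<^sub>R (?A *v u + ?B *v ((1 / 2) *\<^sub>R (?Eu *v u))) =
      stack (a + (\<eta> * \<rho> / 2) *\<^sub>R (?Eo *v u)) (- (a + (\<eta> * \<rho> / 2) *\<^sub>R (?Eo *v u)))" for a u
    unfolding stack_residual_half by (simp add: scaleR_stack stack_add)
  have stack_eq: "stack a (- a) = stack b (- b) \<longleftrightarrow> a = b" for a b :: "real^('m \<times> 'p)"
  proof
    assume "stack a (- a) = stack b (- b)"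
    then have "stack a (- a) $ Inl i = stack b (- b) $ Inl i" for i
      by simp
    then show "a = b"
      by (simp add: stack_def vec_eq_iff)
  qed simp
  show ?thesis
  proof
    assume "network_ADMM G f \<rho> \<eta> P x z l"
    note run = this[unfolded network_ADMM_def generalized_ADMM_def, rule_format]
    have zs: "is_arg_min (\<lambda>w. ?L (x (Suc k)) w (l k)) (\<lambda>_. True) (z (Suc k))"
      and ls: "l (Suc k) = l k + (\<eta> * \<rho>) *\<^sub>R (?A *v x (Suc k) + ?B *v z (Suc k))" for k
      using run[of k] by simp_all
    define \<alpha> where "\<alpha> k = \<alpha>0 + (\<eta> * \<rho> / 2) *\<^sub>R (\<Sum>t<k. ?Eo *v x (Suc t))" for k
    have \<alpha>_Suc: "\<alpha> (Suc k) = \<alpha> k + (\<eta> * \<rho> / 2) *\<^sub>R (?Eo *v x (Suc k))" for k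
      by (simp add: \<alpha>_def scaleR_add_right)
    have inv: "z k = (1 / 2) *\<^sub>R (?Eu *v x k) \<and> l k = stack (\<alpha> k) (- \<alpha> k)" for k
    proof (induction k)
      case 0
      show ?case
        by (simp add: l0 z0 \<alpha>_def)
    next
      case (Suc k)
      then have lk: "l k = stack (\<alpha> k) (- \<alpha> k)" ..
      have zk: "z (Suc k) = (1 / 2) *\<^sub>R (?Eu *v x (Suc k))"
        using zs[of k] unfolding lk z_step .
      moreover have "l (Suc k) = stack (\<alpha> (Suc k)) (- \<alpha> (Suc k))"
        unfolding ls lk zk l_step \<alpha>_Suc ..
      ultimately show ?case ..
    qed
    have "is_arg_min (?J (\<alpha> k) (x k)) (\<lambda>_. True) (x (Suc k))" for k
      using run[of k, THEN conjunct1]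
      unfolding conjunct1[OF inv[of k]] conjunct2[OF inv[of k]] x_step .
    then have "D_ADMM G f \<rho> \<eta> P x \<alpha>"
      unfolding D_ADMM_def using \<alpha>_Suc by blast
    moreover have "\<alpha> 0 = \<alpha>0"
      by (simp add: \<alpha>_def)
    ultimately show "\<exists>\<alpha>. \<alpha> 0 = \<alpha>0 \<and> D_ADMM G f \<rho> \<eta> P x \<alpha> \<and>
        (\<forall>k. z k = (1 / 2) *\<^sub>R (E_u G *v x k) \<and> l k = stack (\<alpha> k) (- \<alpha> k))"
      using inv by blast
  next
    assume "\<exists>\<alpha>. \<alpha> 0 = \<alpha>0 \<and> D_ADMM G f \<rho> \<eta> P x \<alpha> \<and>
        (\<forall>k. z k = (1 / 2) *\<^sub>R (E_u G *v x k) \<and> l k = stack (\<alpha> k) (- \<alpha> k))"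
    then obtain \<alpha> where run: "D_ADMM G f \<rho> \<eta> P x \<alpha>"
      and z: "\<And>k. z k = (1 / 2) *\<^sub>R (E_u G *v x k)" and l: "\<And>k. l k = stack (\<alpha> k) (- \<alpha> k)"
      by blast
    show "network_ADMM G f \<rho> \<eta> P x z l"
      unfolding network_ADMM_def generalized_ADMM_def z l x_step z_step l_step stack_eq
      using run[unfolded D_ADMM_def] by simp
  qed
qed

theorem theorem2:
  fixes G :: "('n::finite, 'm::finite) pre_digraph"
    and f :: "'n \<Rightarrow> real^'p::finite \<Rightarrow> real"
    and \<rho> \<xi> \<eta> :: real
    and Pi_mat W Wt :: "real^'n^'n"
    and P :: "real^('n \<times> 'p)^('n \<times> 'p)"
  assumes "network G"
    and "\<And>i. convex_on UNIV (f i)"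
    and "\<And>i y. f i differentiable (at y)"
    and "\<rho> > 0" and "\<xi> > 0" and "0 < \<eta>" and "\<eta> < (1 + sqrt 5) / 2"
    and "P = Pi_mat \<otimes>\<^sub>K mat 1"
    and "Pi_mat = (1 / \<xi>) *\<^sub>R (mat 1 - (\<xi> * \<rho>) *\<^sub>R degree_matrix G)"
    and "W = mat 1 - (\<xi> * \<rho> / 2) *\<^sub>R laplacian G"
    and "Wt = mat 1 - (\<xi> * \<rho> / 2 * (1 - \<eta>)) *\<^sub>R laplacian G"
    \<comment> \<open>The first four conjuncts say that the choice of \<open>Pi_mat\<close> is admissible: it is always diagonal, and
        positive semidefinite for small enough \<open>\<xi>\<close>, respectively \<open>\<rho>\<close>. The next two say that a run of
        generalized D-ADMM is a run of P-EXTRA precisely for the initialization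
        \<open>\<alpha>\<^sup>0 = (\<eta>\<rho>/2) E\<^sub>o x\<^sup>0\<close>, and that every run of P-EXTRA arises in this way. The last two say
        the same for generalized ADMM itself.\<close>
  shows
    "diagonal_matrix Pi_mat \<and>
     (pos_semidef Pi_mat \<longleftrightarrow> (\<forall>i. \<xi> * \<rho> * degree_matrix G $ i $ i \<le> 1)) \<and>
     (\<forall>r>0. \<exists>s0>0. \<forall>s. 0 < s \<and> s \<le> s0 \<longrightarrow>
        pos_semidef ((1 / s) *\<^sub>R (mat 1 - (s * r) *\<^sub>R degree_matrix G))) \<and>
     (\<forall>s>0. \<exists>r0>0. \<forall>r. 0 < r \<and> r \<le> r0 \<longrightarrow>
        pos_semidef ((1 / s) *\<^sub>R (mat 1 - (s * r) *\<^sub>R degree_matrix G))) \<and>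
     (\<forall>x (\<alpha> :: nat \<Rightarrow> real^('m \<times> 'p)).
        \<alpha> 0 \<in> range (\<lambda>y. E_o G *v y) \<and> D_ADMM G f \<rho> \<eta> P x \<alpha> \<longrightarrow>
        (P_EXTRA (objective f) \<xi> W Wt x \<longleftrightarrow> \<alpha> 0 = (\<eta> * \<rho> / 2) *\<^sub>R (E_o G *v x 0))) \<and>
     (\<forall>x. P_EXTRA (objective f) \<xi> W Wt x \<longrightarrow>
        (\<exists>\<alpha> :: nat \<Rightarrow> real^('m \<times> 'p).
           \<alpha> 0 \<in> range (\<lambda>y. E_o G *v y) \<and> D_ADMM G f \<rho> \<eta> P x \<alpha>)) \<and>
     (\<forall>x z l (\<alpha>0 :: real^('m \<times> 'p)).
        standard_init G (x 0) (z 0) (l 0) \<alpha>0 \<and> network_ADMM G f \<rho> \<eta> P x z l \<longrightarrow>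
        (P_EXTRA (objective f) \<xi> W Wt x \<longleftrightarrow> \<alpha>0 = (\<eta> * \<rho> / 2) *\<^sub>R (E_o G *v x 0))) \<and>
     (\<forall>x. P_EXTRA (objective f) \<xi> W Wt x \<longrightarrow>
        (\<exists>z l (\<alpha>0 :: real^('m \<times> 'p)).
           standard_init G (x 0) (z 0) (l 0) \<alpha>0 \<and> network_ADMM G f \<rho> \<eta> P x z l))"
proof -
  note Pi = \<open>Pi_mat = (1 / \<xi>) *\<^sub>R (mat 1 - (\<xi> * \<rho>) *\<^sub>R degree_matrix G)\<close>
  have P: "P = (1 / \<xi>) *\<^sub>R mat 1 - \<rho> *\<^sub>R D_mat G"
    unfolding \<open>P = Pi_mat \<otimes>\<^sub>K mat 1\<close> Pi D_mat_eq_kron[OF \<open>network G\<close>] kron_scaleR kron_diff kron_mat_1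
    using \<open>\<xi> > 0\<close> by (simp add: scaleR_diff_right)
  note setting = assms(1-3) \<open>\<xi> > 0\<close> P assms(10,11)
  have z0: "E_u G *v v = 2 *\<^sub>R w \<longleftrightarrow> w = (1 / 2) *\<^sub>R (E_u G *v v)"
    for v :: "real^('n \<times> 'p)" and w :: "real^('m \<times> 'p)"
    by auto
  have ADMM_iff: "P_EXTRA (objective f) \<xi> W Wt x \<longleftrightarrow> \<alpha>0 = (\<eta> * \<rho> / 2) *\<^sub>R (E_o G *v x 0)"
    if start: "standard_init G (x 0) (z 0) (l 0) \<alpha>0" and run: "network_ADMM G f \<rho> \<eta> P x z l"
    for x z l and \<alpha>0 :: "real^('m \<times> 'p)"
  proof -
    have init: "l 0 = stack \<alpha>0 (- \<alpha>0)" "\<alpha>0 \<in> range (\<lambda>y. E_o G *v y)"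
        "z 0 = (1 / 2) *\<^sub>R (E_u G *v x 0)"
      using start by (simp_all add: standard_init_def z0)
    obtain \<alpha> where "\<alpha> 0 = \<alpha>0" "D_ADMM G f \<rho> \<eta> P x \<alpha>"
      using run network_ADMM_iff_D_ADMM[where l = l and z = z and x = x, OF \<open>\<rho> > 0\<close> init(1,3)] by blast
    with D_ADMM_P_EXTRA_iff[OF setting, where \<alpha> = \<alpha> and x = x] init(2) show ?thesis
      by simp
  qed
  have ex_ADMM: "\<exists>z l (\<alpha>0 :: real^('m \<times> 'p)).
      standard_init G (x 0) (z 0) (l 0) \<alpha>0 \<and> network_ADMM G f \<rho> \<eta> P x z l"
    if run: "P_EXTRA (objective f) \<xi> W Wt x" for x
  proof -
    obtain \<alpha> :: "nat \<Rightarrow> real^('m \<times> 'p)"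
      where \<alpha>: "\<alpha> 0 \<in> range (\<lambda>y. E_o G *v y)" "D_ADMM G f \<rho> \<eta> P x \<alpha>"
      using P_EXTRA_imp_ex_D_ADMM[OF setting run] by blast
    define z :: "nat \<Rightarrow> real^('m \<times> 'p)" where "z k = (1 / 2) *\<^sub>R (E_u G *v x k)" for k
    define l where "l k = stack (\<alpha> k) (- \<alpha> k)" for k
    have "network_ADMM G f \<rho> \<eta> P x z l"
      using \<alpha>(2) network_ADMM_iff_D_ADMM[where l = l and z = z and x = x, OF \<open>\<rho> > 0\<close> l_def z_def]
      by (auto simp: z_def l_def)
    moreover have "standard_init G (x 0) (z 0) (l 0) (\<alpha> 0)"
      using \<alpha>(1) by (simp add: standard_init_def z_def l_def)
    ultimately show ?thesis
      by blast
  qed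
  have diag: "diagonal_matrix Pi_mat"
    unfolding Pi by (rule diagonal_proximal_matrix)
  have psd: "pos_semidef Pi_mat \<longleftrightarrow> (\<forall>i. \<xi> * \<rho> * degree_matrix G $ i $ i \<le> 1)"
    unfolding Pi using \<open>\<xi> > 0\<close> by (rule pos_semidef_proximal_matrix_iff)
  show ?thesis
    by (intro conjI allI impI; (elim conjE)?;
        (rule diag
         | rule psd
         | rule ex_pos_semidef_proximal_matrix, assumption
         | rule D_ADMM_P_EXTRA_iff[OF setting], assumption+
         | rule P_EXTRA_imp_ex_D_ADMM[OF setting], assumption
         | rule ADMM_iff, assumption+
         | rule ex_ADMM, assumption))
qed

end
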